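(* Let $\mathcal{A}$ be a finite-dimensional algebra over a field $\mathbb{F}$, let $S \subseteq \mathcal{A}$ and let $m \geq 1$ be an integer. (1) If $\mathcal{A}$ is mixing, then $\mathcal{L}_{m+1}(S) = \mathcal{L}_m(S) \cdot S + S \cdot \mathcal{L}_m(S) + \mathcal{L}_m(S)$. (2) If $\mathcal{A}$ is left sliding, then $\mathcal{L}_{m+1}(S) = S \cdot \mathcal{L}_m(S) + \mathcal{L}_m(S)$. (3) If $\mathcal{A}$ is right sliding, then $\mathcal{L}_{m+1}(S) = \mathcal{L}_m(S) \cdot S + \mathcal{L}_m(S)$.
   Context: $\mathcal{A}$ is possibly non-unital and non-associative. If $\mathcal{A}$ is unital, its unity is denoted by $e$. For $S \subseteq \mathcal{A}$ and $k\ge 1$, a word of length $k$ in $S$ is any product of $k$ elements of $S$, with any arrangement of brackets. If $\mathcal{A}$ is unital, $e$ is a word of length $0$; otherwise there are no words of length $0$. $S^k$ is the set of all words in $S$ of length at most $k$, and $\mathcal{L}_k(S)$ is the linear span of $S^k$. In particular, $\mathcal{L}_1(S)$ is the span of $S$ (together with $e$ if $\mathcal{A}$ is unital). For subsets $X,Y\subseteq \mathcal{A}$, in the formulas above $X\cdot Y$ denotes the linear span of all products $xy$ with $x\in X$, $y\in Y$, and $+$ is the sum of subspaces. For $x,y,z\in\mathcal{A}$ put $Q_l(x,y,z) = \{ x(zy), x(yz), y(xz), y(zx), xy, yx, xz, zx, yz, zy, x, y, z \}$, $Q_r(x,y,z) = \{ (xz)y, (zx)y, (yz)x, (zy)x,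 xy, yx, xz, zx, yz, zy, x, y, z \}$, $P(x,y,z) = Q_l(x,y,z)\cup Q_r(x,y,z)$. $\mathcal{A}$ is left sliding if $(xy)z\in\mathcal{L}_1(Q_l(x,y,z))$ for all $x,y,z\in\mathcal{A}$; right sliding if $z(xy)\in\mathcal{L}_1(Q_r(x,y,z))$ for all $x,y,z\in\mathcal{A}$; mixing if $(xy)z,\ z(xy)\in\mathcal{L}_1(P(x,y,z))$ for all $x,y,z\in\mathcal{A}$. *)

theory Defs
  imports Complex_Main "HOL-Library.Set_Algebras"
begin

locale nonassoc_algebra = vector_space scale
  for scale :: "'f::field \<Rightarrow> 'a::ab_group_add \<Rightarrow> 'a" +
  fixes mult :: "'a \<Rightarrow> 'a \<Rightarrow> 'a"
  assumes mult_add_left: "mult (x + y) z = mult x z + mult y z"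
    and mult_add_right: "mult x (y + z) = mult x y + mult x z"
    and mult_scale_left: "mult (scale c x) y = scale c (mult x y)"
    and mult_scale_right: "mult x (scale c y) = scale c (mult x y)"

context
  fixes mult :: "'a \<Rightarrow> 'a \<Rightarrow> 'a"  (infixl \<open>\<cdot>\<close> 70)
begin

definition is_unity :: "'a \<Rightarrow> bool" where
  "is_unity e \<longleftrightarrow> (\<forall>x. e \<cdot> x = x \<and> x \<cdot> e = x)"

(* The rule word_unity applies only if a unity exists, so a non-unital algebra has no words of
   length 0. The side conditions in word_mult keep the unity from occurring as a factor. *)
inductive word :: "'a set \<Rightarrow> nat \<Rightarrow> 'a \<Rightarrow> bool" for S where
  word_unity: "is_unity e \<Longrightarrow> word S 0 e"
| word_gen: "s \<in> S \<Longrightarrow> word S 1 s"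
| word_mult: "1 \<le> i \<Longrightarrow> 1 \<le> j \<Longrightarrow> word S i u \<Longrightarrow> word S j v \<Longrightarrow> word S (i + j) (u \<cdot> v)"

definition words_upto :: "nat \<Rightarrow> 'a set \<Rightarrow> 'a set" where
  "words_upto k S = {w. \<exists>j\<le>k. word S j w}"

definition Q_left :: "'a \<Rightarrow> 'a \<Rightarrow> 'a \<Rightarrow> 'a set" where
  "Q_left x y z =
     {x \<cdot> (z \<cdot> y), x \<cdot> (y \<cdot> z), y \<cdot> (x \<cdot> z), y \<cdot> (z \<cdot> x),
      x \<cdot> y, y \<cdot> x, x \<cdot> z, z \<cdot> x, y \<cdot> z, z \<cdot> y, x, y, z}"

definition Q_right :: "'a \<Rightarrow> 'a \<Rightarrow> 'a \<Rightarrow> 'a set" where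
  "Q_right x y z =
     {(x \<cdot> z) \<cdot> y, (z \<cdot> x) \<cdot> y, (y \<cdot> z) \<cdot> x, (z \<cdot> y) \<cdot> x,
      x \<cdot> y, y \<cdot> x, x \<cdot> z, z \<cdot> x, y \<cdot> z, z \<cdot> y, x, y, z}"

definition P_mixing :: "'a \<Rightarrow> 'a \<Rightarrow> 'a \<Rightarrow> 'a set" where
  "P_mixing x y z = Q_left x y z \<union> Q_right x y z"

end

context
  fixes scale :: "'f::field \<Rightarrow> 'a::ab_group_add \<Rightarrow> 'a"
    and mult :: "'a \<Rightarrow> 'a \<Rightarrow> 'a"  (infixl \<open>\<cdot>\<close> 70)
begin

definition word_span :: "nat \<Rightarrow> 'a set \<Rightarrow> 'a set" where
  "word_span k S = module.span scale (words_upto mult k S)"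

definition span_prod :: "'a set \<Rightarrow> 'a set \<Rightarrow> 'a set" where
  "span_prod X Y = module.span scale {x \<cdot> y | x y. x \<in> X \<and> y \<in> Y}"

definition left_sliding :: bool where
  "left_sliding \<longleftrightarrow> (\<forall>x y z. (x \<cdot> y) \<cdot> z \<in> word_span 1 (Q_left mult x y z))"

definition right_sliding :: bool where
  "right_sliding \<longleftrightarrow> (\<forall>x y z. z \<cdot> (x \<cdot> y) \<in> word_span 1 (Q_right mult x y z))"

definition mixing :: bool where
  "mixing \<longleftrightarrow> (\<forall>x y z. (x \<cdot> y) \<cdot> z \<in> word_span 1 (P_mixing mult x y z) \<and>
                       z \<cdot> (x \<cdot> y) \<in> word_span 1 (P_mixing mult x y z))"

end

end

theory Submission
  imports Defs
begin

text \<open>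
  A word of length \<open>m + 1 \<ge> 2\<close> is a product \<open>uv\<close> of two shorter words. As long as
  the shorter factor (for sliding algebras: the left, respectively right, factor) is not a generator,
  it is itself a product \<open>ab\<close>, and the defining identity replaces \<open>uv\<close> modulo
  \<open>L_m(S)\<close> by products in which \<open>a\<close> or \<open>b\<close> is a factor of its own; so the length of
  that factor drops until it is a generator. The right sliding case is the left sliding case of the
  opposite algebra.
\<close>

section \<open>Words of small length\<close>

lemma word_0_iff: "word mult S 0 w \<longleftrightarrow> is_unity mult w"
  by (subst word.simps) auto

lemma word_1_iff: "word mult S 1 w \<longleftrightarrow> w \<in> S"
  by (subst word.simps) auto

lemma word_ge_2E:
  assumes "word mult S n w" "2 \<le> n"
  obtains i j u v where "1 \<le> i" "1 \<le> j" "n = i + j" "w = mult u v" "word mult S i u" "word mult S j v"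
  using assms by (cases rule: word.cases) auto

lemma words_upto_mono: "k \<le> l \<Longrightarrow> words_upto mult k S \<subseteq> words_upto mult l S"
  unfolding words_upto_def using le_trans by blast

lemma word_in_words_upto: "word mult S j w \<Longrightarrow> j \<le> k \<Longrightarrow> w \<in> words_upto mult k S"
  unfolding words_upto_def by blast

lemma words_upto_1: "words_upto mult 1 S = {e. is_unity mult e} \<union> S"
proof -
  have "(\<exists>j\<le>1. word mult S j w) \<longleftrightarrow> word mult S 0 w \<or> word mult S 1 w" for w
    by (metis le_numeral_extra(4) less_one nat_less_le zero_le)
  then show ?thesis
    unfolding words_upto_def word_0_iff word_1_iff by blast
qed

section \<open>Passing to the opposite algebra\<close>

lemma word_opposite:
  assumes "word mult S n w"
  shows "word (\<lambda>x y. mult y x) S n w"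
  using assms
proof induction
  case (word_unity e)
  then show ?case
    by (simp add: word_0_iff is_unity_def)
next
  case (word_gen s)
  then show ?case
    by (rule word.word_gen)
next
  case (word_mult i j u v)
  then show ?case
    using word.word_mult[of j i "\<lambda>x y. mult y x" S v u] by (simp add: add.commute)
qed

lemma word_span_opposite: "word_span scale (\<lambda>x y. mult y x) = word_span scale mult"
proof -
  \<comment> \<open>Reversing the product twice gives back \<open>mult\<close>, so the one
    implication in \<open>word_opposite\<close> yields both directions.\<close>
  have "word (\<lambda>x y. mult y x) S n w \<longleftrightarrow> word mult S n w" for S n w
    using word_opposite[of mult S n w] word_opposite[of "\<lambda>x y. mult y x" S n w] by auto
  then show ?thesis
    by (simp add: fun_eq_iff word_span_def words_upto_def)
qed

lemma span_prod_opposite: "span_prod scale (\<lambda>x y. mult y x) X Y = span_prod scale mult Y X"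
  unfolding span_prod_def by (rule arg_cong[where f = "module.span scale"]) blast

lemma left_sliding_opposite: "left_sliding scale (\<lambda>x y. mult y x) \<longleftrightarrow> right_sliding scale mult"
proof -
  \<comment> \<open>Here \<open>x\<close> and \<open>y\<close> trade places because
    \<open>(xy)z\<close> in the opposite algebra is \<open>z(yx)\<close> in the original
    one.\<close>
  have "Q_left (\<lambda>x y. mult y x) x y z = Q_right mult y x z" for x y z
    unfolding Q_left_def Q_right_def by (intro equalityI) simp_all
  then show ?thesis
    unfolding left_sliding_def right_sliding_def word_span_opposite[of scale mult] by auto
qed

section \<open>Subspaces spanned by words and their products\<close>

context nonassoc_algebra
begin

lemma nonassoc_algebra_opposite: "nonassoc_algebra scale (\<lambda>x y. mult y x)"
  by unfold_locales (simp_all add: mult_add_left mult_add_right mult_scale_left mult_scale_right)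

lemma mult_zero_right: "mult x 0 = 0"
  using mult_add_right[of x 0 0] by simp

lemma subspace_word_span: "subspace (word_span scale mult k S)"
  unfolding word_span_def by (rule subspace_span)

lemma word_in_word_span: "word mult S j w \<Longrightarrow> j \<le> k \<Longrightarrow> w \<in> word_span scale mult k S"
  unfolding word_span_def by (intro span_base word_in_words_upto)

lemma word_span_mono: "k \<le> l \<Longrightarrow> word_span scale mult k S \<subseteq> word_span scale mult l S"
  unfolding word_span_def by (intro span_mono words_upto_mono)

lemma mult_in_span_prod: "x \<in> X \<Longrightarrow> y \<in> Y \<Longrightarrow> mult x y \<in> span_prod scale mult X Y"
  unfolding span_prod_def by (intro span_base) blast

text \<open>This is how the sliding and mixing identities are applied. Words of length at most 1 in
  \<open>Q\<close> are its elements and a possible unity, so the unity has to be treated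
  separately.\<close>

lemma word_span_1_subset:
  assumes "subspace T" "Q \<subseteq> T" "\<And>e. is_unity mult e \<Longrightarrow> e \<in> T"
  shows "word_span scale mult 1 Q \<subseteq> T"
  unfolding word_span_def words_upto_1 using assms by (intro span_minimal) auto

lemma span_prod_word_span_subset:
  "span_prod scale mult S (word_span scale mult m S) \<subseteq> word_span scale mult (m + 1) S"
proof -
  have "mult s w \<in> word_span scale mult (m + 1) S"
    if s: "s \<in> S" and w: "w \<in> word_span scale mult m S" for s w
  proof -
    \<comment> \<open>Left multiplication by \<open>s\<close> is linear, so the preimage of a
      subspace is a subspace and only words remain to be checked.\<close>
    have "subspace {w. mult s w \<in> word_span scale mult (m + 1) S}"
      by (rule subspaceI)
        (simp_all only: mem_Collect_eq mult_zero_right mult_add_right mult_scale_right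
          subspace_0[OF subspace_word_span] subspace_add[OF subspace_word_span]
          subspace_scale[OF subspace_word_span])
    moreover have "mult s v \<in> word_span scale mult (m + 1) S" if v: "v \<in> words_upto mult m S" for v
    proof -
      obtain j where j: "j \<le> m" "word mult S j v"
        using v unfolding words_upto_def by blast
      have s1: "word mult S 1 s"
        using s by (rule word.word_gen)
      show ?thesis
      \<comment> \<open>A word of length 0 is the unity, which \<open>word_mult\<close> does not
        admit as a factor; then \<open>sv = s\<close> has length 1, which is at most
        \<open>m + 1\<close>.\<close>
      proof (cases "j = 0")
        case True
        then have "mult s v = s"
          using j by (simp add: word_0_iff is_unity_def)
        then show ?thesis
          using word_in_word_span[OF s1, of "m + 1"] by simp
      next
        case False
        then have "word mult S (1 + j) (mult s v)"
          by (intro word.word_mult s1 j(2)) simp_all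
        then show ?thesis
          by (rule word_in_word_span) (simp add: j(1))
      qed
    qed
    ultimately have "word_span scale mult m S \<subseteq> {w. mult s w \<in> word_span scale mult (m + 1) S}"
      unfolding word_span_def[of _ _ m] by (intro span_minimal) auto
    then show ?thesis
      using w by blast
  qed
  then show ?thesis
    unfolding span_prod_def by (intro span_minimal subspace_word_span) auto
qed

lemma span_prod_word_span_subset':
  "span_prod scale mult (word_span scale mult m S) S \<subseteq> word_span scale mult (m + 1) S"
  using nonassoc_algebra.span_prod_word_span_subset[OF nonassoc_algebra_opposite, of S m]
  by (simp add: word_span_opposite[of scale mult] span_prod_opposite[of scale mult])

lemma subspace_span_prod: "subspace (span_prod scale mult X Y)"
  unfolding span_prod_def by (rule subspace_span)

lemma subspace_set_plus:
  assumes "subspace A" "subspace B"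
  shows "subspace (A + B)"
proof -
  have "A + B = {x + y |x y. x \<in> A \<and> y \<in> B}"
    unfolding set_plus_def by blast
  then show ?thesis
    using subspace_sums[OF assms] by (simp only:)
qed

lemma subset_set_plus_left: "subspace B \<Longrightarrow> A \<subseteq> A + B"
  using set_plus_intro[of _ A 0 B] subspace_0[of B] by (auto simp only: add_0_right)

lemma subset_set_plus_right: "subspace A \<Longrightarrow> B \<subseteq> A + B"
  using set_plus_intro[of 0 A _ B] subspace_0[of A] by (auto simp only: add_0_left)

lemma set_plus_subset: "subspace C \<Longrightarrow> A \<subseteq> C \<Longrightarrow> B \<subseteq> C \<Longrightarrow> A + B \<subseteq> C"
  by (auto elim!: set_plus_elim intro!: subspace_add)

section \<open>Rewriting products of two words\<close>

lemma word_span_Suc_subset: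
  assumes T: "subspace T" "word_span scale mult m S \<subseteq> T" and "1 \<le> m"
    and prod: "\<And>i j u v. 1 \<le> i \<Longrightarrow> 1 \<le> j \<Longrightarrow> i + j = m + 1 \<Longrightarrow> word mult S i u \<Longrightarrow> word mult S j v
      \<Longrightarrow> mult u v \<in> T"
  shows "word_span scale mult (m + 1) S \<subseteq> T"
  unfolding word_span_def
proof (intro span_minimal T(1) subsetI)
  fix w assume "w \<in> words_upto mult (m + 1) S"
  then obtain n where n: "n \<le> m + 1" "word mult S n w"
    unfolding words_upto_def by blast
  show "w \<in> T"
  proof (cases "n \<le> m")
    case True
    then show ?thesis
      using n(2) T(2) word_in_word_span by blast
  next
    \<comment> \<open>Since \<open>m\<close> is at least 1, a word of length \<open>m + 1\<close> is
      neither the unity nor a generator, so it splits into two factors.\<close>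
    case False
    then have "n = m + 1" "2 \<le> n"
      using n(1) \<open>1 \<le> m\<close> by auto
    then show ?thesis
      using prod word_ge_2E[OF n(2)] by metis
  qed
qed

text \<open>These are the members of \<open>Q_left\<close> and \<open>Q_right\<close> with at most
  two factors. Each omitted factor has length at least 1, so the total length falls to at most
  \<open>m\<close>.\<close>

lemma short_products_in_word_span:
  assumes "word mult S p x" "word mult S q y" "word mult S r z"
    and "1 \<le> p" "1 \<le> q" "1 \<le> r" "p + q + r = m + 1"
  shows "{mult x y, mult y x, mult x z, mult z x, mult y z, mult z y, x, y, z}
    \<subseteq> word_span scale mult m S"
proof -
  have 1: "w \<in> word_span scale mult m S" if "word mult S i w" "i \<le> m" for i w
    using that by (rule word_in_word_span)
  have 2: "mult u v \<in> word_span scale mult m S"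
    if "word mult S i u" "word mult S j v" "1 \<le> i" "1 \<le> j" "i + j \<le> m" for i j u v
    using that by (intro 1[of "i + j"] word.word_mult)
  show ?thesis
    using assms by (auto intro: 1 2)
qed

text \<open>The target \<open>T\<close> is kept abstract: the argument only needs a subspace that
  contains \<open>L_m(S)\<close> and absorbs products of \<open>L_m(S)\<close> with generators on
  both sides. It is an induction on the length of the shorter factor.\<close>

lemma mult_words_in_mixing:
  assumes mix: "mixing scale mult"
    and T: "subspace T" "word_span scale mult m S \<subseteq> T"
    and left: "\<And>s w. s \<in> S \<Longrightarrow> w \<in> word_span scale mult m S \<Longrightarrow> mult s w \<in> T"
    and right: "\<And>s w. s \<in> S \<Longrightarrow> w \<in> word_span scale mult m S \<Longrightarrow> mult w s \<in> T"
    and "1 \<le> i" "1 \<le> j" "i + j = m + 1" "word mult S i u" "word mult S j v"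
  shows "mult u v \<in> T"
  using assms(6-)
proof (induction "min i j" arbitrary: i j u v rule: less_induct)
  case less
  have unity: "e \<in> T" if "is_unity mult e" for e
    using T(2) word_in_word_span[OF word.word_unity[OF that]] by blast
  \<comment> \<open>Here \<open>xy\<close> is the shorter factor and \<open>z\<close> the other one.
    In every triple product of \<open>P_mixing\<close> the factor outside the inner brackets is
    \<open>x\<close> or \<open>y\<close>, which is shorter than \<open>xy\<close>, so the induction
    hypothesis applies.\<close>
  have P: "P_mixing mult x y z \<subseteq> T"
    if xyz: "word mult S p x" "word mult S q y" "word mult S r z"
      and pqr: "1 \<le> p" "1 \<le> q" "1 \<le> r" "p + q + r = m + 1" "p + q = min i j" for p q r x y z
  proof -
    \<comment> \<open>\<open>Q_left\<close> supplies products with the short factor \<open>a\<close>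
      on the left, \<open>Q_right\<close> those with it on the right.\<close>
    have prods: "mult a (mult b c) \<in> T \<and> mult (mult b c) a \<in> T"
      if "word mult S k a" "word mult S l b" "word mult S n c"
        "1 \<le> k" "1 \<le> l" "1 \<le> n" "k + l + n = m + 1" "k < min i j" for a b c k l n
    proof -
      have "word mult S (l + n) (mult b c)"
        using that by (intro word.word_mult)
      moreover have "min k (l + n) < min i j" "min (l + n) k < min i j"
        using that by auto
      ultimately show ?thesis
        using less.hyps[of k "l + n" a "mult b c"] less.hyps[of "l + n" k "mult b c" a] that by auto
    qed
    have "mult x (mult z y) \<in> T \<and> mult (mult z y) x \<in> T"
      by (rule prods[OF xyz(1,3,2)]) (use pqr in linarith)+
    moreover have "mult x (mult y z) \<in> T \<and> mult (mult y z) x \<in> T"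
      by (rule prods[OF xyz(1,2,3)]) (use pqr in linarith)+
    moreover have "mult y (mult x z) \<in> T \<and> mult (mult x z) y \<in> T"
      by (rule prods[OF xyz(2,1,3)]) (use pqr in linarith)+
    moreover have "mult y (mult z x) \<in> T \<and> mult (mult z x) y \<in> T"
      by (rule prods[OF xyz(2,3,1)]) (use pqr in linarith)+
    moreover note subset_trans[OF short_products_in_word_span[OF xyz pqr(1-4)] T(2)]
    ultimately show ?thesis
      unfolding P_mixing_def Q_left_def Q_right_def by simp
  qed
  have red: "word_span scale mult 1 (P_mixing mult x y z) \<subseteq> T"
    if "word mult S p x" "word mult S q y" "word mult S r z"
      and "1 \<le> p" "1 \<le> q" "1 \<le> r" "p + q + r = m + 1" "p + q = min i j" for p q r x y z
    using that by (intro word_span_1_subset T(1) P unity)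
  \<comment> \<open>Either some factor is a generator, or the shorter one splits; a tie falls under
    both of the last two cases.\<close>
  consider "i = 1" | "j = 1" | "2 \<le> i" "i \<le> j" | "2 \<le> j" "j \<le> i"
    using less.prems by linarith
  then show ?case
  proof cases
    case 1
    then show ?thesis
      using less.prems left word_1_iff[of mult S u] word_in_word_span by auto
  next
    case 2
    then show ?thesis
      using less.prems right word_1_iff[of mult S v] word_in_word_span by auto
  next
    case 3
    obtain p q x y where pq: "1 \<le> p" "1 \<le> q" "i = p + q" "u = mult x y"
      "word mult S p x" "word mult S q y"
      using word_ge_2E[OF less.prems(4) 3(1)] .
    have "word_span scale mult 1 (P_mixing mult x y v) \<subseteq> T"
      using pq 3 less.prems by (intro red[of p x q y j]) auto
    then show ?thesis
      using mix pq(4) unfolding mixing_def by blast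
  next
    \<comment> \<open>Now the right factor splits, so the condition on \<open>z(xy)\<close> in
      \<open>mixing\<close> is used with \<open>z = u\<close>.\<close>
    case 4
    obtain p q x y where pq: "1 \<le> p" "1 \<le> q" "j = p + q" "v = mult x y"
      "word mult S p x" "word mult S q y"
      using word_ge_2E[OF less.prems(5) 4(1)] .
    have "word_span scale mult 1 (P_mixing mult x y u) \<subseteq> T"
      using pq 4 less.prems by (intro red[of p x q y i]) auto
    then show ?thesis
      using mix pq(4) unfolding mixing_def by blast
  qed
qed

text \<open>Now the induction is on the length of the left factor, however long the right one
  becomes. All triple products in \<open>Q_left\<close> have \<open>x\<close> or \<open>y\<close>
  alone on the left, and each is shorter than \<open>xy\<close>.\<close>

lemma mult_words_in_left_sliding:
  assumes sliding: "left_sliding scale mult"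
    and T: "subspace T" "word_span scale mult m S \<subseteq> T"
    and left: "\<And>s w. s \<in> S \<Longrightarrow> w \<in> word_span scale mult m S \<Longrightarrow> mult s w \<in> T"
    and "1 \<le> i" "1 \<le> j" "i + j = m + 1" "word mult S i u" "word mult S j v"
  shows "mult u v \<in> T"
  using assms(5-)
proof (induction i arbitrary: j u v rule: less_induct)
  case (less i)
  show ?case
  proof (cases "i = 1")
    case True
    then show ?thesis
      using less.prems left word_1_iff[of mult S u] word_in_word_span by auto
  next
    case False
    then have "2 \<le> i"
      using less.prems by simp
    then obtain p q x y where pq: "1 \<le> p" "1 \<le> q" "i = p + q" "u = mult x y"
      "word mult S p x" "word mult S q y"
      using word_ge_2E[OF less.prems(4)] by metis
    have prods: "mult a (mult b c) \<in> T"
      if "word mult S k a" "word mult S l b" "word mult S n c"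
        "1 \<le> k" "1 \<le> l" "1 \<le> n" "k + l + n = m + 1" "k < i" for a b c k l n
      using that less.IH[of k "l + n" a "mult b c"] word.word_mult[of l n mult S b c] by auto
    have sum: "p + q + j = m + 1"
      using pq(3) less.prems(3) by simp
    note words = pq(5,6) less.prems(5)
    have "mult x (mult v y) \<in> T"
      by (rule prods[OF words(1,3,2)]) (use pq(1-3) less.prems(2) sum in linarith)+
    moreover have "mult x (mult y v) \<in> T"
      by (rule prods[OF words(1,2,3)]) (use pq(1-3) less.prems(2) sum in linarith)+
    moreover have "mult y (mult x v) \<in> T"
      by (rule prods[OF words(2,1,3)]) (use pq(1-3) less.prems(2) sum in linarith)+
    moreover have "mult y (mult v x) \<in> T"
      by (rule prods[OF words(2,3,1)]) (use pq(1-3) less.prems(2) sum in linarith)+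
    moreover note subset_trans[OF short_products_in_word_span[OF words pq(1,2) less.prems(2) sum] T(2)]
    ultimately have "Q_left mult x y v \<subseteq> T"
      unfolding Q_left_def by simp
    moreover have "e \<in> T" if "is_unity mult e" for e
      using T(2) word_in_word_span[OF word.word_unity[OF that]] by blast
    ultimately have "word_span scale mult 1 (Q_left mult x y v) \<subseteq> T"
      by (intro word_span_1_subset T(1))
    then show ?thesis
      using sliding pq(4) unfolding left_sliding_def by blast
  qed
qed

section \<open>The three identities\<close>

lemma word_span_Suc_mixing:
  assumes "mixing scale mult" "1 \<le> m"
  shows "word_span scale mult (m + 1) S =
    span_prod scale mult (word_span scale mult m S) S
      + span_prod scale mult S (word_span scale mult m S)
      + word_span scale mult m S" (is "_ = ?R + ?L + ?W")
proof
  have sub: "subspace ?R" "subspace ?L" "subspace ?W" "subspace (?R + ?L)" "subspace (?R + ?L + ?W)"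
    by (intro subspace_set_plus subspace_span_prod subspace_word_span)+
  have incl: "?R \<subseteq> ?R + ?L + ?W" "?L \<subseteq> ?R + ?L + ?W" "?W \<subseteq> ?R + ?L + ?W"
    using subset_set_plus_left[OF sub(2), of ?R] subset_set_plus_right[OF sub(1), of ?L]
      subset_set_plus_left[OF sub(3), of "?R + ?L"] subset_set_plus_right[OF sub(4), of ?W] by auto
  show "word_span scale mult (m + 1) S \<subseteq> ?R + ?L + ?W"
  \<comment> \<open>The right-hand side itself serves as \<open>T\<close>; \<open>incl\<close>
    provides the inclusion of \<open>L_m(S)\<close> and the absorption of generators.\<close>
  proof (rule word_span_Suc_subset[OF sub(5) incl(3) assms(2)])
    fix i j u v
    assume "1 \<le> i" "1 \<le> j" "i + j = m + 1" "word mult S i u" "word mult S j v"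
    then show "mult u v \<in> ?R + ?L + ?W"
      using mult_words_in_mixing[OF assms(1) sub(5) incl(3)] incl mult_in_span_prod by blast
  qed
  show "?R + ?L + ?W \<subseteq> word_span scale mult (m + 1) S"
    by (intro set_plus_subset subspace_word_span span_prod_word_span_subset
        span_prod_word_span_subset' word_span_mono) simp
qed

lemma word_span_Suc_left_sliding:
  assumes "left_sliding scale mult" "1 \<le> m"
  shows "word_span scale mult (m + 1) S =
    span_prod scale mult S (word_span scale mult m S) + word_span scale mult m S" (is "_ = ?L + ?W")
proof
  have sub: "subspace ?L" "subspace ?W" "subspace (?L + ?W)"
    by (intro subspace_set_plus subspace_span_prod subspace_word_span)+
  have incl: "?L \<subseteq> ?L + ?W" "?W \<subseteq> ?L + ?W"
    using sub by (simp_all add: subset_set_plus_left subset_set_plus_right)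
  show "word_span scale mult (m + 1) S \<subseteq> ?L + ?W"
  proof (rule word_span_Suc_subset[OF sub(3) incl(2) assms(2)])
    fix i j u v
    assume "1 \<le> i" "1 \<le> j" "i + j = m + 1" "word mult S i u" "word mult S j v"
    then show "mult u v \<in> ?L + ?W"
      using mult_words_in_left_sliding[OF assms(1) sub(3) incl(2)] incl mult_in_span_prod by blast
  qed
  show "?L + ?W \<subseteq> word_span scale mult (m + 1) S"
    by (intro set_plus_subset subspace_word_span span_prod_word_span_subset word_span_mono) simp
qed

text \<open>In the opposite algebra the left sliding identity applies; translating back leaves
  \<open>L_m(S)\<close> unchanged and reverses the order in \<open>span_prod\<close>.\<close>

lemma word_span_Suc_right_sliding:
  assumes "right_sliding scale mult" "1 \<le> m"
  shows "word_span scale mult (m + 1) S =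
    span_prod scale mult (word_span scale mult m S) S + word_span scale mult m S"
  using nonassoc_algebra.word_span_Suc_left_sliding[OF nonassoc_algebra_opposite, of m S] assms
  by (simp add: word_span_opposite[of scale mult] span_prod_opposite[of scale mult]
      left_sliding_opposite[of scale mult])

end

theorem lemma2p8:
  fixes scale :: "'f::field \<Rightarrow> 'a::ab_group_add \<Rightarrow> 'a"
    and mult :: "'a \<Rightarrow> 'a \<Rightarrow> 'a"
    and S :: "'a set"
    and m :: nat
  assumes "nonassoc_algebra scale mult"
    and "\<exists>Basis. finite_dimensional_vector_space scale Basis"
    and "1 \<le> m"
  shows "(mixing scale mult \<longrightarrow>
            word_span scale mult (m + 1) S =
              span_prod scale mult (word_span scale mult m S) S
              + span_prod scale mult S (word_span scale mult m S)
              + word_span scale mult m S) \<and>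
         (left_sliding scale mult \<longrightarrow>
            word_span scale mult (m + 1) S =
              span_prod scale mult S (word_span scale mult m S) + word_span scale mult m S) \<and>
         (right_sliding scale mult \<longrightarrow>
            word_span scale mult (m + 1) S =
              span_prod scale mult (word_span scale mult m S) S + word_span scale mult m S)"
  using nonassoc_algebra.word_span_Suc_mixing[OF assms(1) _ assms(3)]
    nonassoc_algebra.word_span_Suc_left_sliding[OF assms(1) _ assms(3)]
    nonassoc_algebra.word_span_Suc_right_sliding[OF assms(1) _ assms(3)]
  by blast

end
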